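(* Let $\zeta_1,\ldots,\zeta_n$ be i.i.d. real random variables, let $S_i=\sum_{j=1}^i\zeta_j$ for $i=0,\ldots,n$, let $B\subseteq\mathbb{R}$ be a Borel set with $\mathbb{P}(S_n\in B)>0$, and consider the random walk conditioned on $\{S_n\in B\}$. Let $\sigma=\max\{i\le n: S_i\le 0\}$ and assume that $\mathbb{P}(S_\sigma=0\mid S_n\in B)>0$. Then on the event $\{S_\sigma=0\}$ (i.e. under $\mathbb{P}(\,\cdot\mid S_n\in B,\ S_\sigma=0)$) the random variables $N^-,\ N^+,\ \overrightarrow{F},\ \overleftarrow{F},\ \overrightarrow{G},\ \overleftarrow{G}$ all have the same distribution.
   Context: $S_0=0$, so $\sigma\in\{0,\ldots,n\}$ is well defined. Let $\underline{S}=\min\{S_i: i\le\sigma\}$ and $\overline{S}=\max\{S_i: i\le\sigma\}$, where indices $i$ range over non-negative integers. Define $$N^-=\sum_{i=1}^{\sigma}\mathbf{1}_{\{S_i\le 0\}},\qquad N^+=\sum_{i=1}^{\sigma}\mathbf{1}_{\{S_i\ge 0\}},$$ $$\overrightarrow{F}=\max\{i\le\sigma: S_i=\underline{S}\},\qquad \overrightarrow{G}=\max\{i\le\sigma: S_i=\overline{S}\},$$ $$\overleftarrow{F}=\sigma-\min\{i\le\sigma: S_i=\underline{S}\},\qquad \overleftarrow{G}=\sigma-\min\{i\le\sigma: S_i=\overline{S}\}.$$ Empty sums are $0$. *)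

theory Defs
  imports "HOL-Probability.Probability"
begin

definition walk :: "(nat \<Rightarrow> 'a \<Rightarrow> real) \<Rightarrow> 'a \<Rightarrow> nat \<Rightarrow> real" where
  "walk \<zeta> \<omega> i = (\<Sum>j=1..i. \<zeta> j \<omega>)"

text \<open>The following functionals take the horizon \<open>n\<close> and a path \<open>s\<close>, of which only
  the values \<open>s 0, \<dots>, s n\<close> matter. They are meant for paths with \<open>s 0 = 0\<close>, so that
  the set under \<open>Max\<close> in \<open>last_nonpos\<close> (the time written \<open>\<sigma>\<close> in the mathematics)
  contains \<open>0\<close>.\<close>

definition last_nonpos :: "nat \<Rightarrow> (nat \<Rightarrow> real) \<Rightarrow> nat" where
  "last_nonpos n s = Max {i. i \<le> n \<and> s i \<le> 0}"

definition walk_min :: "nat \<Rightarrow> (nat \<Rightarrow> real) \<Rightarrow> real" where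
  "walk_min n s = Min {s i |i. i \<le> last_nonpos n s}"

definition walk_max :: "nat \<Rightarrow> (nat \<Rightarrow> real) \<Rightarrow> real" where
  "walk_max n s = Max {s i |i. i \<le> last_nonpos n s}"

definition N_minus :: "nat \<Rightarrow> (nat \<Rightarrow> real) \<Rightarrow> nat" where
  "N_minus n s = (\<Sum>i=1..last_nonpos n s. of_bool (s i \<le> 0))"

definition N_plus :: "nat \<Rightarrow> (nat \<Rightarrow> real) \<Rightarrow> nat" where
  "N_plus n s = (\<Sum>i=1..last_nonpos n s. of_bool (s i \<ge> 0))"

definition F_right :: "nat \<Rightarrow> (nat \<Rightarrow> real) \<Rightarrow> nat" where
  "F_right n s = Max {i. i \<le> last_nonpos n s \<and> s i = walk_min n s}"

definition G_right :: "nat \<Rightarrow> (nat \<Rightarrow> real) \<Rightarrow> nat" where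
  "G_right n s = Max {i. i \<le> last_nonpos n s \<and> s i = walk_max n s}"

definition F_left :: "nat \<Rightarrow> (nat \<Rightarrow> real) \<Rightarrow> nat" where
  "F_left n s = last_nonpos n s - Min {i. i \<le> last_nonpos n s \<and> s i = walk_min n s}"

definition G_left :: "nat \<Rightarrow> (nat \<Rightarrow> real) \<Rightarrow> nat" where
  "G_left n s = last_nonpos n s - Min {i. i \<le> last_nonpos n s \<and> s i = walk_max n s}"

end

theory Submission
  imports Defs "HOL-Combinatorics.Multiset_Permutations"
begin

text \<open>Fix \<open>k\<close> and consider the event that \<open>\<sigma> = k\<close>, \<open>S\<^sub>k = 0\<close> and \<open>S\<^sub>n \<in> B\<close>. It depends only on the
  values \<open>S\<^sub>k, \<dots>, S\<^sub>n\<close>, so it is unchanged when the first \<open>k\<close> steps are permuted, and since the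
  steps are i.i.d. the probabilities are unchanged too. Averaging over all \<open>k!\<close> orders therefore
  reduces the claim to a deterministic one: for real numbers with sum \<open>0\<close>, each of the six functionals
  of the closed path takes a given value for the same number of orderings
  (\<open>bridge_functionals_equidistributed\<close>). The
  transfer is \<open>bridge_functionals_same_probability\<close>, and summing over \<open>k\<close> gives the theorem.

  The deterministic statement combines three symmetries.
  \<^item> For any real numbers, the number of nonnegative partial sums and the time of the last maximum
    agree in distribution over orderings (\<open>sparre_andersen_permutations\<close>). Applied to the steps and
    to their negatives, this relates \<open>N\<^sup>+\<close> to the last maximum and \<open>N\<^sup>-\<close> to the last minimum.
  \<^item> Reversing the order of the steps of a bridge reverses time and changes the sign of the path. This
    relates the last maximum to the first minimum, and the last minimum to the first maximum, both
    counted from the end.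
  \<^item> On the cycle formed by a bridge, the distance from a uniformly chosen starting point back to the
    nearest maximum has the same distribution as the distance forward to it, since both are determined by the gaps
    between successive maxima in the same way. This relates the last maximum to the first maximum
    counted from the end (\<open>last_max_time_rotate\<close>), and thereby connects maxima with minima.\<close>

section \<open>Counting nonnegative values and locating the last maximum\<close>
definition nonneg_count :: "nat \<Rightarrow> (nat \<Rightarrow> real) \<Rightarrow> nat" where
  "nonneg_count k s = (\<Sum>i=1..k. of_bool (0 \<le> s i))"

definition last_max_time :: "nat \<Rightarrow> (nat \<Rightarrow> real) \<Rightarrow> nat" where
  "last_max_time k s = Max {i. i \<le> k \<and> (\<forall>j\<le>k. s j \<le> s i)}"

text \<open>Steps are given by \<open>x\<close> on an index set and visited in the order of the list \<open>p\<close>. Permuting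
  indices instead of values means that equal steps need no separate treatment in the counts below.\<close>
definition partial_sums :: "('b \<Rightarrow> real) \<Rightarrow> 'b list \<Rightarrow> nat \<Rightarrow> real" where
  "partial_sums x p i = sum_list (map x (take i p))"

lemma max_times_nonempty:
  fixes s :: "nat \<Rightarrow> real"
  shows "{i. i \<le> k \<and> (\<forall>j\<le>k. s j \<le> s i)} \<noteq> {}"
proof -
  have "Max (s ` {..k}) \<in> s ` {..k}" by (rule Max_in) auto
  then obtain i where "Max (s ` {..k}) = s i" "i \<le> k" by (rule imageE) auto
  moreover have "s j \<le> Max (s ` {..k})" if "j \<le> k" for j
    using that by (intro Max_ge) auto
  ultimately show ?thesis by auto
qed

lemma last_max_time_iff:
  "last_max_time k s = r \<longleftrightarrow>
     r \<le> k \<and> (\<forall>j\<le>k. s j \<le> s r) \<and> (\<forall>j\<le>k. r < j \<longrightarrow> s j < s r)"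
    (is "?L \<longleftrightarrow> ?R")
proof
  let ?A = "{i. i \<le> k \<and> (\<forall>j\<le>k. s j \<le> s i)}"
  assume L: ?L
  have r: "r \<in> ?A"
    using Max_in[OF _ max_times_nonempty, of k s] L by (auto simp: last_max_time_def)
  have "s j < s r" if "j \<le> k" "r < j" for j
  proof (rule ccontr)
    assume "\<not> s j < s r"
    then have "j \<in> ?A" using r that by force
    then have "j \<le> r" using L by (auto simp: last_max_time_def)
    then show False using that by simp
  qed
  then show ?R using r by auto
next
  assume ?R
  then show ?L unfolding last_max_time_def
    by (intro Max_eqI) (auto simp: not_le[symmetric])
qed

text \<open>Being below \<open>m\<close> is a statement about an interval of times, namely that no time from \<open>m\<close> on
  is a maximum. In this form the last maximum can be followed through a rotation of the path.\<close>
lemma last_max_time_less_iff: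
  "last_max_time k s < m \<longleftrightarrow> (\<forall>i\<le>k. (\<forall>j\<le>k. s j \<le> s i) \<longrightarrow> i < m)"
  unfolding last_max_time_def using max_times_nonempty[of k s] by (subst Max_less_iff) auto

lemma last_max_time_cong:
  "(\<And>i. i \<le> k \<Longrightarrow> s i = t i) \<Longrightarrow> last_max_time k s = last_max_time k t"
  unfolding last_max_time_def by (intro arg_cong[where f = Max]) auto

lemma nonneg_count_cong:
  "(\<And>i. i \<le> k \<Longrightarrow> s i = t i) \<Longrightarrow> nonneg_count k s = nonneg_count k t"
  unfolding nonneg_count_def by (intro sum.cong) auto

section \<open>Counting orderings\<close>
lemma card_Collect_bij:
  assumes "bij_betw h P P"
  shows "card {p \<in> P. Q (h p)} = card {p \<in> P. Q p}"
proof (rule bij_betw_same_card)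
  show "bij_betw h {p \<in> P. Q (h p)} {p \<in> P. Q p}"
    using assms by (auto simp: bij_betw_def inj_on_def image_iff) 
qed

lemma bij_betw_permutations_of_set_rev:
  "bij_betw rev (permutations_of_set I) (permutations_of_set I)"
  by (rule bij_betw_byWitness[of _ rev]) (auto simp: permutations_of_set_def)

lemma card_permutations_Cons:
  assumes "finite I" "I \<noteq> {}"
  shows "card {p \<in> permutations_of_set I. Q p} =
    (\<Sum>a\<in>I. card {p \<in> permutations_of_set (I - {a}). Q (a # p)})"
proof -
  have "{p \<in> permutations_of_set I. Q p} =
      (\<Union>a\<in>I. (#) a ` {p \<in> permutations_of_set (I - {a}). Q (a # p)})"
    using assms by (subst permutations_of_set_nonempty) auto
  also have "card \<dots> = (\<Sum>a\<in>I. card ((#) a ` {p \<in> permutations_of_set (I - {a}). Q (a # p)}))"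
    using assms by (intro card_UN_disjoint) auto
  finally show ?thesis by (simp add: card_image)
qed

lemma card_permutations_snoc:
  assumes "finite I" "I \<noteq> {}"
  shows "card {p \<in> permutations_of_set I. Q p} =
    (\<Sum>a\<in>I. card {p \<in> permutations_of_set (I - {a}). Q (p @ [a])})"
proof -
  have "card {p \<in> permutations_of_set I. Q p} = card {p \<in> permutations_of_set I. Q (rev p)}"
    by (rule card_Collect_bij[symmetric, OF bij_betw_permutations_of_set_rev])
  also have "\<dots> = (\<Sum>a\<in>I. card {p \<in> permutations_of_set (I - {a}). Q (rev p @ [a])})"
    using card_permutations_Cons[OF assms, of "\<lambda>p. Q (rev p)"] by simp
  also have "\<dots> = (\<Sum>a\<in>I. card {p \<in> permutations_of_set (I - {a}). Q (p @ [a])})"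
    by (intro sum.cong refl
        card_Collect_bij[where Q = "\<lambda>p. Q (p @ [_])", OF bij_betw_permutations_of_set_rev])
  finally show ?thesis .
qed

section \<open>Sparre Andersen's identity for permutations\<close>
lemma partial_sums_snoc:
  "i \<le> length p \<Longrightarrow> partial_sums x (p @ [a]) i = partial_sums x p i"
  by (simp add: partial_sums_def)

lemma partial_sums_Cons: "partial_sums x (a # p) (Suc i) = x a + partial_sums x p i"
  by (simp add: partial_sums_def)

lemma partial_sums_0 [simp]: "partial_sums x p 0 = 0"
  by (simp add: partial_sums_def)

lemma partial_sums_permutation_total:
  assumes "p \<in> permutations_of_set I"
  shows "partial_sums x p (card I) = (\<Sum>i\<in>I. x i)"
proof -
  have "partial_sums x p (card I) = sum_list (map x p)"
    using length_finite_permutations_of_set[OF assms] by (simp add: partial_sums_def)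
  then show ?thesis
    using assms by (auto simp: permutations_of_set_def sum_list_distinct_conv_sum_set)
qed

lemma nonneg_count_partial_sums_snoc:
  "nonneg_count (Suc (length p)) (partial_sums x (p @ [a])) =
   nonneg_count (length p) (partial_sums x p) +
     of_bool (0 \<le> partial_sums x (p @ [a]) (Suc (length p)))"
  using nonneg_count_cong[of "length p" "partial_sums x (p @ [a])" "partial_sums x p"]
  by (simp add: nonneg_count_def partial_sums_snoc)

text \<open>A path that ends below its starting value \<open>0\<close> cannot have its maximum at the final time,
  so dropping the last step does not move the last maximum.\<close>
lemma last_max_time_partial_sums_snoc:
  assumes "partial_sums x (p @ [a]) (Suc (length p)) < 0"
  shows "last_max_time (Suc (length p)) (partial_sums x (p @ [a])) =
    last_max_time (length p) (partial_sums x p)"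
proof -
  let ?s = "partial_sums x p" and ?t = "partial_sums x (p @ [a])" and ?k = "length p"
  define r where "r = last_max_time ?k ?s"
  have r: "r \<le> ?k" "\<And>j. j \<le> ?k \<Longrightarrow> ?s j \<le> ?s r"
    "\<And>j. j \<le> ?k \<Longrightarrow> r < j \<Longrightarrow> ?s j < ?s r"
    using last_max_time_iff[of ?k ?s r] by (auto simp: r_def)
  have "?s r \<ge> 0" using r(2)[of 0] by simp
  with assms r have "last_max_time (Suc ?k) ?t = r"
    by (subst last_max_time_iff) (force simp: le_Suc_eq partial_sums_snoc)
  then show ?thesis by (simp add: r_def)
qed

text \<open>A path that ends at or above \<open>0\<close> has a last maximum at a positive time: time \<open>0\<close> is not the
  last maximum, because the final value is at least as large. Hence dropping the first step, which
  shifts all later values by the same amount, moves the last maximum one unit earlier.\<close>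
lemma last_max_time_partial_sums_Cons:
  assumes "partial_sums x (a # p) (Suc (length p)) \<ge> 0"
  shows "last_max_time (Suc (length p)) (partial_sums x (a # p)) =
    Suc (last_max_time (length p) (partial_sums x p))"
proof -
  let ?s = "partial_sums x p" and ?t = "partial_sums x (a # p)" and ?k = "length p"
  define r where "r = last_max_time ?k ?s"
  have r: "r \<le> ?k" "\<And>j. j \<le> ?k \<Longrightarrow> ?s j \<le> ?s r"
    "\<And>j. j \<le> ?k \<Longrightarrow> r < j \<Longrightarrow> ?s j < ?s r"
    using last_max_time_iff[of ?k ?s r] by (auto simp: r_def)
  have 0: "?t (Suc r) \<ge> 0" using r(2)[of ?k] assms by (simp add: partial_sums_Cons)
  have "?t j \<le> ?t (Suc r)" if "j \<le> Suc ?k" for j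
    using that 0 r(2) by (cases j) (auto simp: partial_sums_Cons)
  moreover have "?t j < ?t (Suc r)" if "j \<le> Suc ?k" "Suc r < j" for j
    using that r(3) by (cases j) (auto simp: partial_sums_Cons)
  ultimately have "last_max_time (Suc ?k) ?t = Suc r"
    using r(1) by (subst last_max_time_iff) auto
  then show ?thesis by (simp add: r_def)
qed

text \<open>Feller's induction. The total \<open>\<Sum>i\<in>I. x i\<close> is the same for all orderings. If it is negative,
  deleting the last step changes neither quantity. If it is nonnegative, deleting the last step
  lowers the number of nonnegative partial sums by one, and deleting the first step lowers the time
  of the last maximum by one. Both sides are then sums over the deleted step of counts for
  one index less, and it does not matter that different ends of the list are cut.\<close>
lemma sparre_andersen_permutations:
  assumes "finite I"
  shows "card {p \<in> permutations_of_set I. nonneg_count (card I) (partial_sums x p) = r} =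
    card {p \<in> permutations_of_set I. last_max_time (card I) (partial_sums x p) = r}"
  using assms
proof (induction "card I" arbitrary: I r)
  case 0
  then have "I = {}" by simp
  moreover have "last_max_time 0 (partial_sums x []) = 0" by (subst last_max_time_iff) auto
  ultimately show ?case by (simp add: nonneg_count_def permutations_of_set_empty cong: conj_cong)
next
  case (Suc k)
  have ne: "I \<noteq> {}" using Suc.hyps(2) by auto
  let ?P = "\<lambda>a. permutations_of_set (I - {a})"
  have len: "length p = k" if "p \<in> ?P a" "a \<in> I" for p a
    using length_finite_permutations_of_set[OF that(1)] that(2) Suc by simp
  have tot1: "partial_sums x (p @ [a]) (Suc k) = (\<Sum>i\<in>I. x i)" if "p \<in> ?P a" "a \<in> I" for p a
    using that partial_sums_permutation_total[of "p @ [a]" I x] Suc.hyps(2)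
    by (auto simp: permutations_of_set_def)
  have tot2: "partial_sums x (a # p) (Suc k) = (\<Sum>i\<in>I. x i)" if "p \<in> ?P a" "a \<in> I" for p a
    using that partial_sums_permutation_total[of "a # p" I x] Suc.hyps(2)
    by (auto simp: permutations_of_set_def)
  have IH: "card {p \<in> ?P a. nonneg_count k (partial_sums x p) = q} =
      card {p \<in> ?P a. last_max_time k (partial_sums x p) = q}" if "a \<in> I" for a q
  proof -
    have "k = card (I - {a})" using Suc.hyps(2) Suc.prems that by simp
    then show ?thesis using Suc.hyps(1)[of "I - {a}" q] Suc.prems by simp
  qed
  show ?case
  proof (cases "(\<Sum>i\<in>I. x i) < 0")
    case True
    have "card {p \<in> permutations_of_set I. nonneg_count (card I) (partial_sums x p) = r} =
        (\<Sum>a\<in>I. card {p \<in> ?P a. nonneg_count k (partial_sums x p) = r})"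
      unfolding card_permutations_snoc[OF Suc.prems ne] Suc.hyps(2)[symmetric]
      using True nonneg_count_partial_sums_snoc[of _ x] len tot1
      by (intro sum.cong refl arg_cong[where f = card]) force
    moreover have "card {p \<in> permutations_of_set I. last_max_time (card I) (partial_sums x p) = r} =
        (\<Sum>a\<in>I. card {p \<in> ?P a. last_max_time k (partial_sums x p) = r})"
      unfolding card_permutations_snoc[OF Suc.prems ne] Suc.hyps(2)[symmetric]
      using True last_max_time_partial_sums_snoc[of x] len tot1
      by (intro sum.cong refl arg_cong[where f = card]) force
    ultimately show ?thesis using IH by simp
  next
    case False
    have "card {p \<in> permutations_of_set I. nonneg_count (card I) (partial_sums x p) = r} =
        (\<Sum>a\<in>I. card {p \<in> ?P a. Suc (nonneg_count k (partial_sums x p)) = r})"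
      unfolding card_permutations_snoc[OF Suc.prems ne] Suc.hyps(2)[symmetric]
      using False nonneg_count_partial_sums_snoc[of _ x] len tot1
      by (intro sum.cong refl arg_cong[where f = card]) force
    moreover have "card {p \<in> permutations_of_set I. last_max_time (card I) (partial_sums x p) = r} =
        (\<Sum>a\<in>I. card {p \<in> ?P a. Suc (last_max_time k (partial_sums x p)) = r})"
      unfolding card_permutations_Cons[OF Suc.prems ne] Suc.hyps(2)[symmetric]
      using False last_max_time_partial_sums_Cons[of x] len tot2
      by (intro sum.cong refl arg_cong[where f = card]) force
    moreover have "card {p \<in> ?P a. Suc (nonneg_count k (partial_sums x p)) = r} =
        card {p \<in> ?P a. Suc (last_max_time k (partial_sums x p)) = r}" if "a \<in> I" for a
      using IH[OF that] by (cases r) auto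
    ultimately show ?thesis by simp
  qed
qed

section \<open>Rotating and reversing a bridge\<close>

text \<open>When the total is \<open>0\<close>, rotating the steps moves the path along a closed cycle and shifts all
  values by a constant, so maxima stay maxima. The last maximum of the path is before \<open>m\<close> iff there
  is no maximum among the times \<open>m, \<dots>, k\<close>, with \<open>k\<close> the length; after rotation by \<open>m\<close> these
  are the times \<open>0, \<dots>, k - m\<close>, and no maximum lies there iff the last maximum of the
  time-reversed path is before \<open>m\<close>. A fixed \<open>m\<close> needs its own rotation, and this is why
  cumulative counts are compared rather than counts of single values.\<close>
lemma last_max_time_rotate:
  assumes m: "m \<le> length p" and 0: "partial_sums x p (length p) = 0"
  shows "last_max_time (length p) (partial_sums x p) < m \<longleftrightarrow>
    last_max_time (length p) (\<lambda>i. partial_sums x (drop m p @ take m p) (length p - i)) < m"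
proof -
  let ?k = "length p" and ?s = "partial_sums x p" and ?t = "partial_sums x (drop m p @ take m p)"
  have add: "?s (m + i) = ?s m + sum_list (map x (take i (drop m p)))" for i
    by (simp add: partial_sums_def take_add)
  \<comment> \<open>Both formulas apply at the time \<open>?k - m\<close>, where the cycle closes, because the total is \<open>0\<close>.\<close>
  have t1: "?t i = ?s (m + i) - ?s m" if "i \<le> ?k - m" for i
    using that by (simp add: add) (simp add: partial_sums_def)
  have t2: "?t i = ?s (i - (?k - m)) - ?s m" if "?k - m \<le> i" "i \<le> ?k" for i
  proof -
    have "sum_list (map x (drop m p)) = - ?s m"
      using add[of "?k - m"] m 0 by simp
    then show ?thesis using that m by (simp add: partial_sums_def min_def)
  qed
  have max: "(\<forall>j\<le>?k. ?t j \<le> ?t i) \<longleftrightarrow> (\<forall>j\<le>?k. ?s j \<le> ?s (m + i))" if i: "i \<le> ?k - m" for i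
  proof (intro iffI allI impI)
    fix j assume *: "\<forall>j\<le>?k. ?t j \<le> ?t i" "j \<le> ?k"
    show "?s j \<le> ?s (m + i)"
    proof (cases "m \<le> j")
      case True
      then show ?thesis using *(1)[rule_format, of "j - m"] t1[OF i] t1[of "j - m"] *(2) by simp
    next
      case False
      then show ?thesis
        using *(1)[rule_format, of "j + (?k - m)"] t1[OF i] t2[of "j + (?k - m)"] m by simp
    qed
  next
    fix j assume *: "\<forall>j\<le>?k. ?s j \<le> ?s (m + i)" "j \<le> ?k"
    show "?t j \<le> ?t i"
    proof (cases "j \<le> ?k - m")
      case True
      then show ?thesis using *(1)[rule_format, of "m + j"] t1[OF i] t1[OF True] m by simp
    next
      case False
      then show ?thesis using *(1)[rule_format, of "j - (?k - m)"] *(2) t1[OF i] t2[of j] by simp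
    qed
  qed
  have rev: "(\<forall>j\<le>?k. ?t (?k - j) \<le> ?t i) \<longleftrightarrow> (\<forall>j\<le>?k. ?t j \<le> ?t i)" for i
    by (metis diff_diff_cancel diff_le_self)
  have less: "(\<forall>i\<le>?k. Q i \<longrightarrow> i < m) \<longleftrightarrow> (\<forall>i\<le>?k - m. \<not> Q (m + i))" for Q
  proof (intro iffI allI impI notI)
    fix i assume *: "\<forall>i\<le>?k - m. \<not> Q (m + i)" "i \<le> ?k" "Q i"
    show "i < m" using *(1)[rule_format, of "i - m"] *(2,3) by (cases "i < m") (auto simp: diff_le_mono)
  next
    fix i assume "\<forall>i\<le>?k. Q i \<longrightarrow> i < m" "i \<le> ?k - m" "Q (m + i)"
    moreover have "m + i \<le> ?k" using calculation(2) m by simp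
    ultimately have "m + i < m" by blast
    then show False by simp
  qed
  have less_rev: "(\<forall>i\<le>?k. Q (?k - i) \<longrightarrow> i < m) \<longleftrightarrow> (\<forall>i\<le>?k - m. \<not> Q i)" for Q
  proof (intro iffI allI impI notI)
    fix i assume *: "\<forall>i\<le>?k - m. \<not> Q i" "i \<le> ?k" "Q (?k - i)"
    show "i < m"
    proof (rule ccontr)
      assume "\<not> i < m"
      then have "?k - i \<le> ?k - m" by simp
      then show False using * by blast
    qed
  next
    fix i assume *: "\<forall>i\<le>?k. Q (?k - i) \<longrightarrow> i < m" "i \<le> ?k - m" "Q i"
    show False using *(1)[rule_format, of "?k - i"] *(2,3) m by auto
  qed
  have "last_max_time ?k ?s < m \<longleftrightarrow> (\<forall>i\<le>?k - m. \<not> (\<forall>j\<le>?k. ?s j \<le> ?s (m + i)))"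
    unfolding last_max_time_less_iff by (rule less)
  also have "\<dots> \<longleftrightarrow> (\<forall>i\<le>?k - m. \<not> (\<forall>j\<le>?k. ?t j \<le> ?t i))"
    using max by blast
  also have "\<dots> \<longleftrightarrow> last_max_time ?k (\<lambda>i. ?t (?k - i)) < m"
    unfolding last_max_time_less_iff rev
    by (rule less_rev[where Q = "\<lambda>i. \<forall>j\<le>?k. ?t j \<le> ?t i", symmetric])
  finally show ?thesis .
qed

lemma partial_sums_rev:
  assumes "i \<le> length p"
  shows "partial_sums x (rev p) i = partial_sums x p (length p) - partial_sums x p (length p - i)"
proof -
  have "sum_list (map x p) = sum_list (map x (take (length p - i) p)) + sum_list (map x (drop (length p - i) p))"
    by (metis append_take_drop_id map_append sum_list_append)
  then show ?thesis
    by (simp add: partial_sums_def take_rev rev_map[symmetric])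
qed

lemma partial_sums_uminus: "partial_sums (\<lambda>j. - x j) p i = - partial_sums x p i"
  by (simp add: partial_sums_def uminus_sum_list_map o_def)

lemma bij_betw_permutations_of_set_rotate:
  assumes "finite I"
  shows "bij_betw (\<lambda>p. drop m p @ take m p) (permutations_of_set I) (permutations_of_set I)"
proof -
  have "inj_on (\<lambda>p. drop m p @ take m p) (permutations_of_set I)"
  proof (rule inj_onI)
    fix p q assume *: "p \<in> permutations_of_set I" "q \<in> permutations_of_set I"
      "drop m p @ take m p = drop m q @ take m q"
    have "length p = length q"
      using * by (simp add: length_finite_permutations_of_set)
    then have "drop m p = drop m q \<and> take m p = take m q" using *(3) by simp
    then show "p = q" by (metis append_take_drop_id)
  qed
  moreover have "(\<lambda>p. drop m p @ take m p) ` permutations_of_set I \<subseteq> permutations_of_set I"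
  proof clarify
    fix p assume p: "p \<in> permutations_of_set I"
    have "mset (drop m p @ take m p) = mset p"
      by (metis append_take_drop_id mset_append union_commute)
    then have "set (drop m p @ take m p) = set p" "distinct (drop m p @ take m p) = distinct p"
      by (metis mset_eq_setD, metis mset_eq_imp_distinct_iff)
    then show "drop m p @ take m p \<in> permutations_of_set I"
      using p unfolding permutations_of_set_def by blast
  qed
  ultimately show ?thesis
    using endo_inj_surj[of "permutations_of_set I"] by (simp add: bij_betw_def)
qed

text \<open>For a bridge, reversing the time of the path has the same effect as reversing the order of the
  steps and changing the sign. The rotation therefore turns the last maximum into the last maximum
  of the negated path, after composing with the reversal of the list.\<close>
lemma last_max_time_sign_equidistributed:
  assumes fin: "finite I" and 0: "(\<Sum>i\<in>I. x i) = 0"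
  shows "card {p \<in> permutations_of_set I. last_max_time (card I) (partial_sums x p) = r} =
    card {p \<in> permutations_of_set I. last_max_time (card I) (\<lambda>i. - partial_sums x p i) = r}"
proof -
  let ?P = "permutations_of_set I" and ?k = "card I"
  define f where "f = (\<lambda>p. last_max_time ?k (partial_sums x p))"
  define g where "g = (\<lambda>p. last_max_time ?k (\<lambda>i. - partial_sums x p i))"
  have len: "length p = ?k" if "p \<in> ?P" for p
    using length_finite_permutations_of_set[OF that] .
  have rot_perm: "drop m p @ take m p \<in> ?P" if "p \<in> ?P" for p m
    using bij_betw_permutations_of_set_rotate[OF fin, of m] that by (auto simp: bij_betw_def)
  have rev: "last_max_time ?k (\<lambda>i. partial_sums x p (?k - i)) = g (rev p)" if "p \<in> ?P" for p
    unfolding g_def using that len[OF that] partial_sums_permutation_total[OF that, of x] 0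
    by (intro last_max_time_cong) (simp add: partial_sums_rev)
  have le: "f p \<le> ?k" "g p \<le> ?k" for p
    using last_max_time_iff unfolding f_def g_def by blast+
  have less: "card {p \<in> ?P. f p < m} = card {p \<in> ?P. g p < m}" for m
  proof (cases "m \<le> ?k")
    case True
    have "f p < m \<longleftrightarrow> g (rev (drop m p @ take m p)) < m" if "p \<in> ?P" for p
      using last_max_time_rotate[of m p x] that True len[OF that] 0 rev[OF rot_perm[OF that]]
        partial_sums_permutation_total[OF that, of x] by (simp add: f_def)
    then have "card {p \<in> ?P. f p < m} = card {p \<in> ?P. g (rev (drop m p @ take m p)) < m}"
      by (intro arg_cong[where f = card] Collect_cong) blast
    also have "\<dots> = card {p \<in> ?P. g (rev p) < m}"
      using card_Collect_bij[where Q = "\<lambda>p. g (rev p) < m",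
          OF bij_betw_permutations_of_set_rotate[OF fin]] .
    also have "\<dots> = card {p \<in> ?P. g p < m}"
      using card_Collect_bij[where Q = "\<lambda>p. g p < m", OF bij_betw_permutations_of_set_rev] .
    finally show ?thesis .
  next
    case False
    then have "f p < m" "g p < m" for p using le[of p] by simp_all
    then show ?thesis by simp
  qed
  have diff: "card {p \<in> ?P. h p = r} = card {p \<in> ?P. h p < Suc r} - card {p \<in> ?P. h p < r}"
    for h :: "_ \<Rightarrow> nat"
  proof -
    have "{p \<in> ?P. h p = r} = {p \<in> ?P. h p < Suc r} - {p \<in> ?P. h p < r}" by auto
    moreover have "{p \<in> ?P. h p < r} \<subseteq> {p \<in> ?P. h p < Suc r}" by auto
    moreover have "finite {p \<in> ?P. h p < r}" by simp
    ultimately show ?thesis by (simp only: card_Diff_subset)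
  qed
  show ?thesis using diff[of f] diff[of g] less by (simp add: f_def g_def)
qed

section \<open>The six functionals\<close>
lemma eq_Max_values_iff:
  fixes s :: "nat \<Rightarrow> real"
  assumes "i \<le> m"
  shows "s i = Max {s j |j. j \<le> m} \<longleftrightarrow> (\<forall>j\<le>m. s j \<le> s i)"
proof -
  have "{s j |j. j \<le> m} = s ` {..m}" by auto
  then show ?thesis using assms by (auto simp: eq_Max_iff)
qed

lemma eq_Min_values_iff:
  fixes s :: "nat \<Rightarrow> real"
  assumes "i \<le> m"
  shows "s i = Min {s j |j. j \<le> m} \<longleftrightarrow> (\<forall>j\<le>m. s i \<le> s j)"
proof -
  have "{s j |j. j \<le> m} = s ` {..m}" by auto
  then show ?thesis using assms by (auto simp: eq_Min_iff)
qed

lemma diff_first_max_time: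
  fixes s :: "nat \<Rightarrow> real"
  shows "m - Min {i. i \<le> m \<and> (\<forall>j\<le>m. s j \<le> s i)} = last_max_time m (\<lambda>i. s (m - i))"
proof -
  let ?A = "{i. i \<le> m \<and> (\<forall>j\<le>m. s j \<le> s i)}"
  let ?a = "Min ?A"
  have fin: "finite ?A" by simp
  have a: "?a \<in> ?A" using Min_in[OF fin max_times_nonempty] .
  have min: "?a \<le> i" if "i \<in> ?A" for i using Min_le[OF fin that] .
  have "s (m - j) < s ?a" if "j \<le> m" "m - ?a < j" for j
  proof (rule ccontr)
    assume "\<not> s (m - j) < s ?a"
    then have "m - j \<in> ?A" using a by force
    then have "?a \<le> m - j" by (rule min)
    then show False using that by linarith
  qed
  then have "last_max_time m (\<lambda>i. s (m - i)) = m - ?a"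
    using a by (subst last_max_time_iff) auto
  then show ?thesis ..
qed

lemma last_nonpos_iff:
  assumes "s 0 \<le> 0"
  shows "last_nonpos n s = k \<longleftrightarrow> k \<le> n \<and> s k \<le> 0 \<and> (\<forall>i\<le>n. k < i \<longrightarrow> 0 < s i)"
    (is "?L \<longleftrightarrow> ?R")
proof
  let ?A = "{i. i \<le> n \<and> s i \<le> 0}"
  assume L: ?L
  have "?A \<noteq> {}" using assms by auto
  then have "k \<in> ?A" using Max_in[of ?A] L unfolding last_nonpos_def by fastforce
  moreover have "i \<le> k" if "i \<in> ?A" for i
    using Max_ge[of ?A i] L that by (auto simp: last_nonpos_def)
  ultimately show ?R by force
next
  assume ?R
  then show ?L unfolding last_nonpos_def
    by (intro Max_eqI) (auto simp: not_le[symmetric])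
qed

lemma last_nonpos_le:
  assumes "s 0 \<le> 0"
  shows "last_nonpos n s \<le> n"
  using last_nonpos_iff[of s n "last_nonpos n s"] assms by simp

text \<open>All six functionals are one of two quantities, evaluated on the path up to \<open>last_nonpos n s\<close>
  after a change of sign, a reversal of time, or both.\<close>
lemma path_functionals_eq:
  shows N_plus_eq: "N_plus n s = nonneg_count (last_nonpos n s) s"
    and N_minus_eq: "N_minus n s = nonneg_count (last_nonpos n s) (\<lambda>i. - s i)"
    and G_right_eq: "G_right n s = last_max_time (last_nonpos n s) s"
    and F_right_eq: "F_right n s = last_max_time (last_nonpos n s) (\<lambda>i. - s i)"
    and G_left_eq: "G_left n s = last_max_time (last_nonpos n s) (\<lambda>i. s (last_nonpos n s - i))"
    and F_left_eq: "F_left n s = last_max_time (last_nonpos n s) (\<lambda>i. - s (last_nonpos n s - i))"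
proof -
  show "N_plus n s = nonneg_count (last_nonpos n s) s"
    and "N_minus n s = nonneg_count (last_nonpos n s) (\<lambda>i. - s i)"
    by (simp_all add: N_plus_def N_minus_def nonneg_count_def)
  show "G_right n s = last_max_time (last_nonpos n s) s"
    and "F_right n s = last_max_time (last_nonpos n s) (\<lambda>i. - s i)"
    by (simp_all add: G_right_def F_right_def last_max_time_def walk_max_def walk_min_def
        eq_Max_values_iff eq_Min_values_iff cong: conj_cong)
  show "G_left n s = last_max_time (last_nonpos n s) (\<lambda>i. s (last_nonpos n s - i))"
    using diff_first_max_time[of "last_nonpos n s" s]
    by (simp add: G_left_def walk_max_def eq_Max_values_iff cong: conj_cong)
  show "F_left n s = last_max_time (last_nonpos n s) (\<lambda>i. - s (last_nonpos n s - i))"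
    using diff_first_max_time[of "last_nonpos n s" "\<lambda>i. - s i"]
    by (simp add: F_left_def walk_min_def eq_Min_values_iff cong: conj_cong)
qed

text \<open>The two horizons may differ, so a walk with horizon \<open>n\<close> can be compared with its initial bridge,
  whose horizon is the length \<open>k\<close> of the bridge.\<close>
lemma path_functional_cong:
  assumes "X \<in> {N_minus, N_plus, F_right, F_left, G_right, G_left}"
    and "last_nonpos n s = k" "last_nonpos m t = k"
    and "\<And>i. i \<le> k \<Longrightarrow> s i = t i"
  shows "X n s = X m t"
  using assms(1,4)
  by (auto simp: path_functionals_eq assms(2,3) intro!: nonneg_count_cong last_max_time_cong)

text \<open>For a bridge of length \<open>k\<close> the last nonpositive time within the horizon \<open>k\<close> is \<open>k\<close> itself, so
  the functionals see the whole path. The two counts reduce to the last maximum by Sparre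
  Andersen's identity, the two time-reversed functionals by reversing the list, and the change of
  sign is undone by the rotation argument.\<close>
lemma bridge_functionals_equidistributed:
  assumes "finite I" and 0: "(\<Sum>i\<in>I. x i) = 0"
    and X: "X \<in> {N_minus, N_plus, F_right, F_left, G_right, G_left}"
  shows "card {p \<in> permutations_of_set I. X (card I) (partial_sums x p) = r} =
    card {p \<in> permutations_of_set I. last_max_time (card I) (partial_sums x p) = r}"
proof -
  let ?P = "permutations_of_set I" and ?k = "card I" and ?s = "partial_sums x"
  have end0: "?s p ?k = 0" if "p \<in> ?P" for p
    using partial_sums_permutation_total[OF that] 0 by simp
  have sigma: "last_nonpos ?k (?s p) = ?k" if "p \<in> ?P" for p
    using end0[OF that] by (subst last_nonpos_iff) auto
  have rev: "?s (rev p) i = - ?s p (?k - i)" if "p \<in> ?P" "i \<le> ?k" for p i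
    using that partial_sums_rev[of i p x] end0[OF that(1)]
    by (simp add: length_finite_permutations_of_set)
  \<comment> \<open>The factor \<open>c\<close> is \<open>1\<close> for \<open>G_left\<close> and \<open>-1\<close> for \<open>F_left\<close>.\<close>
  have left: "card {p \<in> ?P. last_max_time ?k (\<lambda>i. c * ?s p (?k - i)) = r} =
      card {p \<in> ?P. last_max_time ?k (\<lambda>i. - c * ?s p i) = r}" for c
  proof -
    have "card {p \<in> ?P. last_max_time ?k (\<lambda>i. c * ?s p (?k - i)) = r} =
        card {p \<in> ?P. last_max_time ?k (\<lambda>i. - c * ?s (rev p) i) = r}"
      using rev by (intro arg_cong[where f = card] Collect_cong conj_cong refl
          arg_cong[where f = "\<lambda>j. j = r"] last_max_time_cong) auto
    also have "\<dots> = card {p \<in> ?P. last_max_time ?k (\<lambda>i. - c * ?s p i) = r}"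
      using card_Collect_bij[where Q = "\<lambda>p. last_max_time ?k (\<lambda>i. - c * ?s p i) = r",
          OF bij_betw_permutations_of_set_rev] .
    finally show ?thesis .
  qed
  note sign = last_max_time_sign_equidistributed[OF assms(1) 0, of r, symmetric]
  note sa = sparre_andersen_permutations[OF assms(1), of x r]
    sparre_andersen_permutations[OF assms(1), of "\<lambda>i. - x i" r, unfolded partial_sums_uminus]
  from X show ?thesis
    using sign sa left[of 1] left[of "-1"]
    by (auto simp: path_functionals_eq sigma cong: conj_cong)
qed

section \<open>Measurability\<close>
lemma measurable_last_max_time:
  assumes [measurable]: "\<And>i. (\<lambda>\<omega>. s \<omega> i) \<in> borel_measurable M"
  shows "(\<lambda>\<omega>. last_max_time k (s \<omega>)) \<in> measurable M (count_space UNIV)"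
  unfolding last_max_time_def by measurable

lemma measurable_path_functional:
  assumes s: "\<And>i. i \<le> n \<Longrightarrow> (\<lambda>\<omega>. s \<omega> i) \<in> borel_measurable M"
    and s0: "\<And>\<omega>. s \<omega> 0 = 0"
  shows "(\<lambda>\<omega>. last_nonpos n (s \<omega>)) \<in> measurable M (count_space UNIV)"
    and "X \<in> {N_minus, N_plus, F_right, F_left, G_right, G_left} \<Longrightarrow>
      (\<lambda>\<omega>. X n (s \<omega>)) \<in> measurable M (count_space UNIV)"
proof -
  \<comment> \<open>Freezing the path at time \<open>n\<close> makes every coordinate measurable and leaves the functionals
      unchanged.\<close>
  define t where "t \<omega> i = s \<omega> (min i n)" for \<omega> i
  have t [measurable]: "(\<lambda>\<omega>. t \<omega> i) \<in> borel_measurable M" for i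
    unfolding t_def by (rule s) simp
  have st: "last_nonpos n (s \<omega>) = last_nonpos n (t \<omega>)" for \<omega>
    unfolding last_nonpos_def t_def by (intro arg_cong[where f = Max]) auto
  have sigma [measurable]: "(\<lambda>\<omega>. last_nonpos n (t \<omega>)) \<in> measurable M (count_space UNIV)"
    unfolding last_nonpos_def by measurable
  then show "(\<lambda>\<omega>. last_nonpos n (s \<omega>)) \<in> measurable M (count_space UNIV)"
    by (simp add: st)
  have comp: "(\<lambda>\<omega>. f (last_nonpos n (t \<omega>)) \<omega>) \<in> measurable M (count_space UNIV)"
    if "\<And>k. f k \<in> measurable M (count_space UNIV)" for f :: "nat \<Rightarrow> 'a \<Rightarrow> nat"
    using that by (rule measurable_compose_countable) (rule sigma)
  have count: "(\<lambda>\<omega>. nonneg_count (last_nonpos n (t \<omega>)) (\<lambda>i. c * t \<omega> i)) \<in> measurable M (count_space UNIV)" for c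
    by (rule comp[where f = "\<lambda>k \<omega>. nonneg_count k (\<lambda>i. c * t \<omega> i)"]) (unfold nonneg_count_def, measurable)
  have last: "(\<lambda>\<omega>. last_max_time (last_nonpos n (t \<omega>)) (\<lambda>i. c * t \<omega> i)) \<in> measurable M (count_space UNIV)" for c
    by (rule comp[where f = "\<lambda>k \<omega>. last_max_time k (\<lambda>i. c * t \<omega> i)"], rule measurable_last_max_time) measurable
  have first: "(\<lambda>\<omega>. last_max_time (last_nonpos n (t \<omega>)) (\<lambda>i. c * t \<omega> (last_nonpos n (t \<omega>) - i))) \<in> measurable M (count_space UNIV)" for c
    by (rule comp[where f = "\<lambda>k \<omega>. last_max_time k (\<lambda>i. c * t \<omega> (k - i))"], rule measurable_last_max_time) measurable
  assume X: "X \<in> {N_minus, N_plus, F_right, F_left, G_right, G_left}"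
  have "last_nonpos n (s \<omega>) \<le> n" for \<omega>
    using s0 by (simp add: last_nonpos_le)
  then have "X n (s \<omega>) = X n (t \<omega>)" for \<omega>
    by (intro path_functional_cong[OF X refl st[symmetric]]) (simp add: t_def le_trans min_absorb1)
  moreover have "(\<lambda>\<omega>. X n (t \<omega>)) \<in> measurable M (count_space UNIV)"
    using X count[of 1] count[of "-1"] last[of 1] last[of "-1"] first[of 1] first[of "-1"]
    by (auto simp: path_functionals_eq)
  ultimately show "(\<lambda>\<omega>. X n (s \<omega>)) \<in> measurable M (count_space UNIV)" by simp
qed

section \<open>From counting orderings to probabilities\<close>

text \<open>This transfers a count over orderings that holds for every outcome to an equality of two
  probabilities: if the events \<open>U p\<close> all have the same measure \<open>u\<close>, then \<open>card G * u\<close> is the integral of the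
  number of \<open>p\<close> for which \<open>U p\<close> occurs.\<close>
lemma emeasure_eq_by_double_counting:
  assumes "finite G" "G \<noteq> {}"
    and [measurable]: "\<And>p. p \<in> G \<Longrightarrow> U p \<in> sets M" "\<And>p. p \<in> G \<Longrightarrow> V p \<in> sets M"
    and U: "\<And>p. p \<in> G \<Longrightarrow> emeasure M (U p) = u" and V: "\<And>p. p \<in> G \<Longrightarrow> emeasure M (V p) = v"
    and card: "\<And>\<omega>. \<omega> \<in> space M \<Longrightarrow> card {p \<in> G. \<omega> \<in> U p} = card {p \<in> G. \<omega> \<in> V p}"
  shows "u = v"
proof -
  have count: "(\<Sum>p\<in>G. emeasure M (W p)) = (\<integral>\<^sup>+\<omega>. of_nat (card {p \<in> G. \<omega> \<in> W p}) \<partial>M)"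
    if W: "\<And>p. p \<in> G \<Longrightarrow> W p \<in> sets M" for W
  proof -
    have "(\<Sum>p\<in>G. emeasure M (W p)) = (\<Sum>p\<in>G. \<integral>\<^sup>+\<omega>. indicator (W p) \<omega> \<partial>M)"
      using W by (intro sum.cong refl) simp
    also have "\<dots> = (\<integral>\<^sup>+\<omega>. (\<Sum>p\<in>G. indicator (W p) \<omega>) \<partial>M)"
      using W by (intro nn_integral_sum[symmetric]) simp
    also have "(\<lambda>\<omega>. \<Sum>p\<in>G. indicator (W p) \<omega> :: ennreal) = (\<lambda>\<omega>. of_nat (card {p \<in> G. \<omega> \<in> W p}))"
      using assms(1) by (simp add: indicator_def of_bool_def[symmetric] sum.If_cases Int_def fun_eq_iff)
    finally show ?thesis .
  qed
  have "of_nat (card G) * u = (\<Sum>p\<in>G. emeasure M (U p))" using U by simp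
  also have "\<dots> = (\<Sum>p\<in>G. emeasure M (V p))"
    using count[of U] count[of V] assms(3,4) card by (simp cong: nn_integral_cong)
  also have "\<dots> = of_nat (card G) * v" using V by simp
  finally show ?thesis
    using assms(1,2) by (simp add: ennreal_mult_cancel_left ennreal_of_nat_eq_real_of_nat)
qed

lemma (in prob_space) iid_exchangeable:
  assumes indep: "indep_vars (\<lambda>_. N) \<zeta> I"
    and ident: "\<forall>i\<in>I. \<forall>j\<in>I. distr M N (\<zeta> i) = distr M N (\<zeta> j)"
    and \<pi>: "\<pi> permutes I"
    and Q: "Measurable.pred (Pi\<^sub>M I (\<lambda>_. N)) Q"
  shows "emeasure M {\<omega> \<in> space M. Q (\<lambda>i\<in>I. \<zeta> (\<pi> i) \<omega>)} = emeasure M {\<omega> \<in> space M. Q (\<lambda>i\<in>I. \<zeta> i \<omega>)}"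
proof (cases "I = {}")
  case True
  then show ?thesis by (simp add: restrict_def)
next
  case False
  have rv: "random_variable N (\<zeta> i)" if "i \<in> I" for i
    using indep that by (auto simp: indep_vars_def)
  have \<pi>_in: "\<pi> i \<in> I" if "i \<in> I" for i using \<pi> that by (simp add: permutes_in_image)
  obtain i0 where "i0 \<in> I" using False by blast
  let ?\<mu> = "distr M N (\<zeta> i0)" and ?P = "Pi\<^sub>M I (\<lambda>_. N)"
  have [measurable]: "(\<lambda>\<omega>. \<lambda>i\<in>I. \<zeta> i \<omega>) \<in> measurable M ?P"
    using rv by (rule measurable_restrict)
  have perm [measurable]: "(\<lambda>x. \<lambda>i\<in>I. x (\<pi> i)) \<in> measurable ?P ?P"
    using \<pi>_in by (intro measurable_restrict measurable_component_singleton)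
  have joint: "distr M ?P (\<lambda>\<omega>. \<lambda>i\<in>I. \<zeta> i \<omega>) = (\<Pi>\<^sub>M i\<in>I. ?\<mu>)"
  proof -
    have "distr M ?P (\<lambda>\<omega>. \<lambda>i\<in>I. \<zeta> i \<omega>) = (\<Pi>\<^sub>M i\<in>I. distr M N (\<zeta> i))"
      using indep_vars_iff_distr_eq_PiM'[where X = \<zeta> and M' = "\<lambda>_. N", OF False rv] indep by blast
    also have "\<dots> = (\<Pi>\<^sub>M i\<in>I. ?\<mu>)"
      using ident \<open>i0 \<in> I\<close> by (intro PiM_cong refl) blast
    finally show ?thesis .
  qed
  have "distr M ?P (\<lambda>\<omega>. \<lambda>i\<in>I. \<zeta> (\<pi> i) \<omega>) =
      distr (distr M ?P (\<lambda>\<omega>. \<lambda>i\<in>I. \<zeta> i \<omega>)) ?P (\<lambda>x. \<lambda>i\<in>I. x (\<pi> i))"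
    using \<pi>_in by (subst distr_distr) (auto simp: o_def intro!: distr_cong)
  also have "\<dots> = distr (\<Pi>\<^sub>M i\<in>I. ?\<mu>) (\<Pi>\<^sub>M i\<in>I. ?\<mu>) (\<lambda>x. \<lambda>i\<in>I. x (\<pi> i))"
    unfolding joint by (intro distr_cong refl sets_PiM_cong) auto
  also have "\<dots> = (\<Pi>\<^sub>M i\<in>I. ?\<mu>)"
    using \<pi> \<pi>_in rv[OF \<open>i0 \<in> I\<close>]
    by (intro distr_PiM_reindex[where M = "\<lambda>_. ?\<mu>"]) (auto intro: prob_space_distr permutes_inj_on)
  finally have eq: "distr M ?P (\<lambda>\<omega>. \<lambda>i\<in>I. \<zeta> (\<pi> i) \<omega>) = distr M ?P (\<lambda>\<omega>. \<lambda>i\<in>I. \<zeta> i \<omega>)"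
    by (simp only: joint)
  let ?A = "{x \<in> space (Pi\<^sub>M I (\<lambda>_. N)). Q x}"
  have law: "emeasure (distr M (Pi\<^sub>M I (\<lambda>_. N)) (\<lambda>\<omega>. \<lambda>i\<in>I. \<xi> i \<omega>)) ?A =
      emeasure M {\<omega> \<in> space M. Q (\<lambda>i\<in>I. \<xi> i \<omega>)}"
    if \<xi>: "\<And>i. i \<in> I \<Longrightarrow> random_variable N (\<xi> i)" for \<xi>
  proof -
    have [measurable]: "(\<lambda>\<omega>. \<lambda>i\<in>I. \<xi> i \<omega>) \<in> measurable M (Pi\<^sub>M I (\<lambda>_. N))"
      using \<xi> by (rule measurable_restrict)
    have "?A \<in> sets (Pi\<^sub>M I (\<lambda>_. N))" using Q by (simp add: pred_def)
    moreover have "(\<lambda>\<omega>. \<lambda>i\<in>I. \<xi> i \<omega>) -` ?A \<inter> space M = {\<omega> \<in> space M. Q (\<lambda>i\<in>I. \<xi> i \<omega>)}"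
      using \<xi> by (auto simp: space_PiM dest: measurable_space)
    ultimately show ?thesis by (simp add: emeasure_distr)
  qed
  show ?thesis
    using law[of \<zeta>] law[of "\<lambda>i. \<zeta> (\<pi> i)"] rv \<pi>_in eq by simp
qed

text \<open>The list \<open>p\<close> reorders the first \<open>length p\<close> steps. Steps are numbered from \<open>1\<close> and list
  positions from \<open>0\<close>; later steps stay in place.\<close>
definition rearrange :: "nat list \<Rightarrow> nat \<Rightarrow> nat" where
  "rearrange p i = (if i \<in> {1..length p} then p ! (i - 1) else i)"

lemma rearrange_permutes:
  assumes p: "p \<in> permutations_of_set {1..k}" and "k \<le> m"
  shows "rearrange p permutes {1..m}"
proof -
  have len: "length p = k" using length_finite_permutations_of_set[OF p] by simp
  have "bij_betw (\<lambda>i. i - 1) {1..k} {..<k}"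
    by (rule bij_betw_byWitness[of _ Suc]) auto
  moreover have "bij_betw ((!) p) {..<k} {1..k}"
    using p len by (intro bij_betw_nth) (auto simp: permutations_of_set_def)
  ultimately have "bij_betw ((!) p \<circ> (\<lambda>i. i - 1)) {1..k} {1..k}"
    by (rule bij_betw_trans)
  then have "bij_betw (rearrange p) {1..k} {1..k}"
    by (rule bij_betw_cong[THEN iffD1, rotated]) (simp add: rearrange_def len)
  then have "rearrange p permutes {1..k}"
    by (rule bij_imp_permutes) (auto simp: rearrange_def len)
  then show ?thesis using permutes_subset[of "rearrange p" "{1..k}" "{1..m}"] \<open>k \<le> m\<close> by simp
qed

lemma walk_rearrange_early:
  assumes "p \<in> permutations_of_set {1..k}" "i \<le> k"
  shows "walk (\<lambda>i. \<zeta> (rearrange p i)) \<omega> i = partial_sums (\<lambda>j. \<zeta> j \<omega>) p i"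
  using assms(2)
proof (induction i)
  case 0
  then show ?case by (simp add: walk_def)
next
  case (Suc i)
  then show ?case using length_finite_permutations_of_set[OF assms(1)]
    by (simp add: walk_def partial_sums_def take_Suc_conv_app_nth rearrange_def)
qed

lemma walk_rearrange_late:
  assumes "p \<in> permutations_of_set {1..k}" "k \<le> i"
  shows "walk (\<lambda>i. \<zeta> (rearrange p i)) \<omega> i = walk \<zeta> \<omega> i"
  unfolding walk_def
  using sum.permute[OF rearrange_permutes[OF assms], of "\<lambda>j. \<zeta> j \<omega>"] by (simp add: o_def)

lemma walk_0 [simp]: "walk \<zeta> \<omega> 0 = 0"
  by (simp add: walk_def)

text \<open>The event that the walk ends in \<open>B\<close>, has last nonpositive time \<open>k\<close> and vanishes there only
  involves the walk from time \<open>k\<close> on. Reordering the first \<open>k\<close> steps does not change it, and on it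
  those steps sum to \<open>0\<close>, so the count for bridges applies. The value of the
  count is the same for all six functionals.\<close>
lemma bridge_functional_count:
  fixes \<zeta> :: "nat \<Rightarrow> 'a \<Rightarrow> real" and \<omega> :: 'a
  assumes k: "k \<le> n"
    and X: "X \<in> {N_minus, N_plus, F_right, F_left, G_right, G_left}"
  defines "S \<equiv> \<lambda>p. walk (\<lambda>i. \<zeta> (rearrange p i)) \<omega>"
  shows "card {p \<in> permutations_of_set {1..k}.
      S p n \<in> B \<and> last_nonpos n (S p) = k \<and> S p k = 0 \<and> X n (S p) = r} =
    (if walk \<zeta> \<omega> n \<in> B \<and> last_nonpos n (walk \<zeta> \<omega>) = k \<and> walk \<zeta> \<omega> k = 0
     then card {p \<in> permutations_of_set {1..k}.
       last_max_time k (partial_sums (\<lambda>j. \<zeta> j \<omega>) p) = r}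
     else 0)"
proof -
  let ?P = "permutations_of_set {1..k}" and ?x = "\<lambda>j. \<zeta> j \<omega>"
  let ?E = "walk \<zeta> \<omega> n \<in> B \<and> last_nonpos n (walk \<zeta> \<omega>) = k \<and> walk \<zeta> \<omega> k = 0"
  have late: "S p i = walk \<zeta> \<omega> i" if "p \<in> ?P" "k \<le> i" for p i
    unfolding S_def by (rule walk_rearrange_late[OF that])
  have S0: "S p 0 = 0" for p by (simp add: S_def)
  have E: "S p n \<in> B \<and> last_nonpos n (S p) = k \<and> S p k = 0 \<longleftrightarrow> ?E" if "p \<in> ?P" for p
    using late[OF that] k by (auto simp: last_nonpos_iff S0)
  have func: "X n (S p) = X k (partial_sums ?x p)" if "p \<in> ?P" "?E" for p
  proof (rule path_functional_cong[OF X])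
    show "last_nonpos n (S p) = k" using E[OF that(1)] that(2) by blast
    show "S p i = partial_sums ?x p i" if "i \<le> k" for i
      unfolding S_def using \<open>p \<in> ?P\<close> that by (rule walk_rearrange_early)
    from this[of k] have "partial_sums ?x p k = 0" using late[OF that(1), of k] that(2) by simp
    then show "last_nonpos k (partial_sums ?x p) = k" by (subst last_nonpos_iff) auto
  qed
  show ?thesis
  proof (cases ?E)
    case True
    then have "(\<Sum>i\<in>{1..k}. ?x i) = 0" by (simp add: walk_def)
    from bridge_functionals_equidistributed[OF _ this X, of r]
    have "card {p \<in> ?P. X k (partial_sums ?x p) = r} = card {p \<in> ?P. last_max_time k (partial_sums ?x p) = r}"
      by simp
    moreover have "{p \<in> ?P. S p n \<in> B \<and> last_nonpos n (S p) = k \<and> S p k = 0 \<and> X n (S p) = r} =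
        {p \<in> ?P. X k (partial_sums ?x p) = r}"
      using E func True by auto
    ultimately show ?thesis by (simp only: if_P[OF True])
  next
    case False
    then have "{p \<in> ?P. S p n \<in> B \<and> last_nonpos n (S p) = k \<and> S p k = 0 \<and> X n (S p) = r} = {}"
      using E by blast
    then show ?thesis by (simp only: if_not_P[OF False] card.empty)
  qed
qed

lemma (in prob_space) bridge_functionals_same_probability:
  assumes indep: "indep_vars (\<lambda>_. borel) \<zeta> {1..n}"
    and ident: "\<forall>i\<in>{1..n}. \<forall>j\<in>{1..n}. distr M borel (\<zeta> i) = distr M borel (\<zeta> j)"
    and B [measurable]: "B \<in> sets borel"
    and k: "k \<le> n"
    and X: "X \<in> {N_minus, N_plus, F_right, F_left, G_right, G_left}"
    and Y: "Y \<in> {N_minus, N_plus, F_right, F_left, G_right, G_left}"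
  defines "S \<equiv> walk \<zeta>"
  shows "emeasure M {\<omega> \<in> space M. S \<omega> n \<in> B \<and> last_nonpos n (S \<omega>) = k \<and> S \<omega> k = 0 \<and> X n (S \<omega>) = r} =
    emeasure M {\<omega> \<in> space M. S \<omega> n \<in> B \<and> last_nonpos n (S \<omega>) = k \<and> S \<omega> k = 0 \<and> Y n (S \<omega>) = r}"
proof -
  let ?P = "permutations_of_set {1..k}" and ?F = "{N_minus, N_plus, F_right, F_left, G_right, G_left}"
  define E where "E Z \<xi> = {\<omega> \<in> space M. walk \<xi> \<omega> n \<in> B \<and> last_nonpos n (walk \<xi> \<omega>) = k \<and>
      walk \<xi> \<omega> k = 0 \<and> Z n (walk \<xi> \<omega>) = r}" for Z \<xi>
  \<comment> \<open>\<open>Q Z\<close> is the event \<open>E Z\<close> as a predicate of the vector of steps, whose law is invariant under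
      permutations.\<close>
  define Q where "Q Z x \<longleftrightarrow> walk (\<lambda>i x. x i) x n \<in> B \<and> last_nonpos n (walk (\<lambda>i x. x i) x) = k \<and>
      walk (\<lambda>i x. x i) x k = 0 \<and> Z n (walk (\<lambda>i x. x i) x) = r" for Z and x :: "nat \<Rightarrow> real"
  have rv: "random_variable borel (\<zeta> i)" if "i \<in> {1..n}" for i
    using indep that by (auto simp: indep_vars_def)
  have Q: "Measurable.pred (Pi\<^sub>M {1..n} (\<lambda>_. borel)) (Q Z)" if "Z \<in> ?F" for Z
  proof -
    have W: "(\<lambda>x. walk (\<lambda>i x. x i) x i) \<in> borel_measurable (Pi\<^sub>M {1..n} (\<lambda>_. borel))" if "i \<le> n" for i
      unfolding walk_def using that by (intro borel_measurable_sum measurable_component_singleton) auto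
    have [measurable]:
      "(\<lambda>x. last_nonpos n (walk (\<lambda>i x. x i) x)) \<in> measurable (Pi\<^sub>M {1..n} (\<lambda>_. borel)) (count_space UNIV)"
      "(\<lambda>x. Z n (walk (\<lambda>i x. x i) x)) \<in> measurable (Pi\<^sub>M {1..n} (\<lambda>_. borel)) (count_space UNIV)"
      by (rule measurable_path_functional(1), rule W, assumption, rule walk_0)
        (rule measurable_path_functional(2)[OF _ _ \<open>Z \<in> ?F\<close>], rule W, assumption, rule walk_0)
    note [measurable] = W[OF order_refl] W[OF k]
    show ?thesis unfolding Q_def by measurable
  qed
  have QE: "{\<omega> \<in> space M. Q Z (\<lambda>i\<in>{1..n}. \<xi> i \<omega>)} = E Z \<xi>" if "Z \<in> ?F" for Z \<xi>
  proof -
    have w: "walk (\<lambda>i x. x i) (\<lambda>i\<in>{1..n}. \<xi> i \<omega>) i = walk \<xi> \<omega> i" if "i \<le> n" for i \<omega>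
      unfolding walk_def using that by (intro sum.cong) auto
    have l: "last_nonpos n (walk (\<lambda>i x. x i) (\<lambda>i\<in>{1..n}. \<xi> i \<omega>)) = last_nonpos n (walk \<xi> \<omega>)" for \<omega>
      unfolding last_nonpos_def using w by (intro arg_cong[where f = Max]) auto
    have "Z n (walk (\<lambda>i x. x i) (\<lambda>i\<in>{1..n}. \<xi> i \<omega>)) = Z n (walk \<xi> \<omega>)" for \<omega>
      using last_nonpos_le[of "walk \<xi> \<omega>" n]
      by (intro path_functional_cong[OF that l refl] w) simp
    then show ?thesis using w k l by (simp add: Q_def E_def)
  qed
  have E_sets: "E Z (\<lambda>i. \<zeta> (rearrange p i)) \<in> sets M" if "Z \<in> ?F" "p \<in> ?P" for Z p
  proof -
    have "(\<lambda>\<omega>. \<lambda>i\<in>{1..n}. \<zeta> (rearrange p i) \<omega>) \<in> measurable M (Pi\<^sub>M {1..n} (\<lambda>_. borel))"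
      using rv permutes_in_image[OF rearrange_permutes[OF that(2) k]]
      by (intro measurable_restrict) blast
    from measurable_compose[OF this Q[OF that(1)]]
    show ?thesis using QE[OF that(1), of "\<lambda>i. \<zeta> (rearrange p i)"] by (simp add: pred_def)
  qed
  have E_measure: "emeasure M (E Z (\<lambda>i. \<zeta> (rearrange p i))) = emeasure M (E Z \<zeta>)"
    if "Z \<in> ?F" "p \<in> ?P" for Z p
    using iid_exchangeable[OF indep ident rearrange_permutes[OF that(2) k] Q[OF that(1)]]
      QE[OF that(1)] by simp
  have "emeasure M (E X \<zeta>) = emeasure M (E Y \<zeta>)"
  proof (rule emeasure_eq_by_double_counting[of ?P "\<lambda>p. E X (\<lambda>i. \<zeta> (rearrange p i))" M
        "\<lambda>p. E Y (\<lambda>i. \<zeta> (rearrange p i))"])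
    fix \<omega> assume "\<omega> \<in> space M"
    then show "card {p \<in> ?P. \<omega> \<in> E X (\<lambda>i. \<zeta> (rearrange p i))} =
        card {p \<in> ?P. \<omega> \<in> E Y (\<lambda>i. \<zeta> (rearrange p i))}"
      using bridge_functional_count[OF k X, of \<zeta> \<omega> B r] bridge_functional_count[OF k Y, of \<zeta> \<omega> B r]
      by (simp add: E_def)
  qed (simp_all only: E_sets E_measure X Y finite_permutations_of_set permutations_of_set_empty_iff finite_atLeastAtMost simp_thms)
  then show ?thesis by (simp add: E_def S_def)
qed

theorem corollary3p1:
  fixes M :: "'a measure" and \<zeta> :: "nat \<Rightarrow> 'a \<Rightarrow> real" and n :: nat and B :: "real set"
  defines "S \<equiv> walk \<zeta>"
  defines "\<sigma> \<equiv> (\<lambda>\<omega>. last_nonpos n (S \<omega>))"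
  defines "P0 \<equiv> uniform_measure M {\<omega> \<in> space M. S \<omega> n \<in> B \<and> S \<omega> (\<sigma> \<omega>) = 0}"
  assumes "prob_space M"
    and indep: "prob_space.indep_vars M (\<lambda>_. borel) \<zeta> {1..n}"
    and ident: "\<forall>i\<in>{1..n}. \<forall>j\<in>{1..n}. distr M borel (\<zeta> i) = distr M borel (\<zeta> j)"
    and "B \<in> sets borel"
    and "\<P>(\<omega> in M. S \<omega> n \<in> B) > 0"
    and "\<P>(\<omega> in M. S \<omega> (\<sigma> \<omega>) = 0 \<bar> S \<omega> n \<in> B) > 0"
  shows "\<forall>X \<in> {N_minus, N_plus, F_right, F_left, G_right, G_left}.
         \<forall>Y \<in> {N_minus, N_plus, F_right, F_left, G_right, G_left}.
           distr P0 (count_space UNIV) (\<lambda>\<omega>. X n (S \<omega>)) =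
           distr P0 (count_space UNIV) (\<lambda>\<omega>. Y n (S \<omega>))"
proof (intro ballI)
  interpret prob_space M by fact
  let ?F = "{N_minus, N_plus, F_right, F_left, G_right, G_left}"
  note [measurable] = \<open>B \<in> sets borel\<close>
  define E where "E = {\<omega> \<in> space M. S \<omega> n \<in> B \<and> S \<omega> (\<sigma> \<omega>) = 0}"
  \<comment> \<open>Only after fixing the value \<open>k\<close> of the random time \<open>\<sigma>\<close> can the first \<open>k\<close> steps be permuted.\<close>
  define D where "D Z r k = {\<omega> \<in> space M. S \<omega> n \<in> B \<and> \<sigma> \<omega> = k \<and> S \<omega> k = 0 \<and> Z n (S \<omega>) = r}"
    for Z :: "nat \<Rightarrow> (nat \<Rightarrow> real) \<Rightarrow> nat" and r k
  have S: "(\<lambda>\<omega>. S \<omega> i) \<in> borel_measurable M" if "i \<le> n" for i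
    using indep that unfolding S_def walk_def
    by (intro borel_measurable_sum) (auto simp: indep_vars_def)
  have S0: "S \<omega> 0 = 0" for \<omega> by (simp add: S_def)
  have \<sigma>_le: "\<sigma> \<omega> \<le> n" for \<omega>
    unfolding \<sigma>_def by (rule last_nonpos_le) (simp add: S0)
  note [measurable] = S[OF order_refl]
  have \<sigma> [measurable]: "\<sigma> \<in> measurable M (count_space UNIV)"
    unfolding \<sigma>_def by (rule measurable_path_functional(1)) (simp_all add: S S0)
  have meas: "(\<lambda>\<omega>. Z n (S \<omega>)) \<in> measurable M (count_space UNIV)" if "Z \<in> ?F" for Z
    by (rule measurable_path_functional(2)[OF _ _ that]) (simp_all add: S S0)
  have D_sets: "D Z r k \<in> sets M" if "Z \<in> ?F" "k \<le> n" for Z r k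
  proof -
    note [measurable] = S[OF \<open>k \<le> n\<close>] meas[OF \<open>Z \<in> ?F\<close>]
    show ?thesis unfolding D_def by measurable
  qed
  have E_UN: "{\<omega> \<in> E. Z n (S \<omega>) = r} = (\<Union>k\<le>n. D Z r k)" for Z r
    using \<sigma>_le by (auto simp: D_def E_def)
  have "E = (\<Union>k\<le>n. {\<omega> \<in> space M. S \<omega> n \<in> B \<and> \<sigma> \<omega> = k \<and> S \<omega> k = 0})"
    using \<sigma>_le by (auto simp: E_def)
  also have "\<dots> \<in> sets M"
  proof (intro sets.finite_UN)
    fix k assume "k \<in> {..n}"
    then have [measurable]: "(\<lambda>\<omega>. S \<omega> k) \<in> borel_measurable M" using S by simp
    show "{\<omega> \<in> space M. S \<omega> n \<in> B \<and> \<sigma> \<omega> = k \<and> S \<omega> k = 0} \<in> sets M" by measurable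
  qed simp
  finally have E_sets: "E \<in> sets M" .
  have law: "emeasure (distr P0 (count_space UNIV) (\<lambda>\<omega>. Z n (S \<omega>))) {r} =
      (\<Sum>k\<le>n. emeasure M (D Z r k)) / emeasure M E" if Z: "Z \<in> ?F" for Z r
  proof -
    note [measurable] = meas[OF Z]
    let ?A = "{\<omega> \<in> space M. Z n (S \<omega>) = r}"
    have "emeasure (distr P0 (count_space UNIV) (\<lambda>\<omega>. Z n (S \<omega>))) {r} = emeasure P0 ?A"
      unfolding P0_def
      by (subst emeasure_distr) (auto intro!: arg_cong2[where f = emeasure])
    also have "\<dots> = emeasure M (E \<inter> ?A) / emeasure M E"
      unfolding P0_def E_def[symmetric] using E_sets by (intro emeasure_uniform_measure) auto
    also have "E \<inter> ?A = (\<Union>k\<le>n. D Z r k)"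
      unfolding E_UN[symmetric] by (auto simp: E_def)
    also have "emeasure M (\<Union>k\<le>n. D Z r k) = (\<Sum>k\<le>n. emeasure M (D Z r k))"
      using D_sets[OF Z] by (intro sum_emeasure[symmetric]) (auto simp: disjoint_family_on_def D_def)
    finally show ?thesis .
  qed
  fix X Y assume X: "X \<in> ?F" and Y: "Y \<in> ?F"
  have D_eq: "emeasure M (D X r k) = emeasure M (D Y r k)" if "k \<le> n" for r k
    using bridge_functionals_same_probability[OF indep ident \<open>B \<in> sets borel\<close> that X Y]
    by (simp add: D_def S_def \<sigma>_def)
  show "distr P0 (count_space UNIV) (\<lambda>\<omega>. X n (S \<omega>)) = distr P0 (count_space UNIV) (\<lambda>\<omega>. Y n (S \<omega>))"
    by (rule measure_eqI_countable[where A = UNIV]) (auto simp: law[OF X] law[OF Y] D_eq)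
qed

end
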